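(* Let $\lambda>0$ and let $\Delta_1,\Delta_2,\ldots$ be IID Laplace$(\lambda)$ random variables, i.e. with density $f_\Delta(\delta)=\frac{\lambda}{2}e^{-\lambda|\delta|}$. Then the minimum over admissible policies of the expected average fast-ramping generation $J_G(\pi,S_1)=\limsup_{n\to\infty}\mathbb{E}\big[\frac1n\sum_{i=1}^nG_i\big]$, which is attained by the policy $\pi^{(1)}$ described in the context, is $$J_G(\pi^{(1)},S_1)=\frac{1-e^{-\lambda G_{\max}}}{2\lambda}\left(\frac{1-\alpha}{1-\alpha e^{-(1/\alpha_c-\alpha_d)\lambda S_{\max}/2}}\right).$$
   Context: Single-bus power system with storage in slotted time $i=1,2,\ldots$. Constants: charging efficiency $\alpha_c\in(0,1)$, discharging efficiency $\alpha_d\in(0,1)$, round-trip efficiency $\alpha=\alpha_c\alpha_d$, fast-ramping generation capacity $G_{\max}\ge 0$, power storage capacity $S_{\max}\ge 0$. The sequence $\Delta_i$ (net renewable generation prediction error) is exogenous. The initial stored power $S_1\in[0,S_{\max}]$ is given. An admissible policy $\pi$ chooses $(G_i,C_i,D_i)$ (fast-ramping generation, charging, discharging) as a measurable function of $(S_1,\Delta_1,\ldots,S_{i-1},\Delta_{i-1},S_i)$ and $\Delta_i$ such that for all $i$: $S_{i+1}=S_i+\alpha_cC_i-\frac1{\alpha_d}D_i$, $0\le S_i\le S_{\max}$, $C_i\ge0$, $D_i\ge0$, $0\le G_i\le G_{\max}$, and $0\le G_i-C_i+D_i+\max\{\Delta_i,-G_{\max}-\alpha_dS_i\}$. The policy $\pi^{(1)}$: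 - if $\frac{S_{\max}-S_i}{\alpha_c}\le\Delta_i$: $(G_i,C_i,D_i)=(0,\frac{S_{\max}-S_i}{\alpha_c},0)$; - if $0\le\Delta_i<\frac{S_{\max}-S_i}{\alpha_c}$: $(0,\Delta_i,0)$; - if $-\alpha_dS_i\le\Delta_i<0$: $(0,0,-\Delta_i)$; - if $-G_{\max}-\alpha_dS_i\le\Delta_i<-\alpha_dS_i$: $(-\Delta_i-\alpha_dS_i,0,\alpha_dS_i)$; - if $\Delta_i<-G_{\max}-\alpha_dS_i$: $(G_{\max},0,\alpha_dS_i)$. *)

theory Defs
  imports "HOL-Probability.Probability"
begin

definition laplace_density :: "real \<Rightarrow> real \<Rightarrow> real" where
  "laplace_density l x = l / 2 * exp (- l * \<bar>x\<bar>)"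

text \<open>
  A policy maps the time slot \<open>i \<ge> 1\<close> and the observed histories \<open>(S\<^sub>1, \<dots>, S\<^sub>i)\<close> and
  \<open>(\<Delta>\<^sub>1, \<dots>, \<Delta>\<^sub>i)\<close>, both functions with extensional domain \<open>{1..i}\<close>, to the triple
  \<open>(G\<^sub>i, C\<^sub>i, D\<^sub>i)\<close> of generation, charging and discharging.
\<close>

type_synonym policy = "nat \<Rightarrow> (nat \<Rightarrow> real) \<times> (nat \<Rightarrow> real) \<Rightarrow> real \<times> real \<times> real"

text \<open>
  The stored power \<open>S\<^sub>i\<close> generated by a policy along an error sequence \<open>d\<close>. Slots start
  at 1; the value at 0 is irrelevant.
\<close>

lemma restrict_cong_fundef [fundef_cong]:
  "A = B \<Longrightarrow> (\<And>x. x \<in> B \<Longrightarrow> f x = g x) \<Longrightarrow> restrict f A = restrict g B"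
  by (auto simp: restrict_def)

fun stored :: "real \<Rightarrow> real \<Rightarrow> real \<Rightarrow> policy \<Rightarrow> (nat \<Rightarrow> real) \<Rightarrow> nat \<Rightarrow> real" where
  "stored \<alpha>c \<alpha>d s1 \<pi> d 0 = s1"
| "stored \<alpha>c \<alpha>d s1 \<pi> d (Suc 0) = s1"
| "stored \<alpha>c \<alpha>d s1 \<pi> d (Suc (Suc k)) =
    (case \<pi> (Suc k) (\<lambda>j\<in>{1..Suc k}. stored \<alpha>c \<alpha>d s1 \<pi> d j, \<lambda>j\<in>{1..Suc k}. d j) of
       (G, C, D) \<Rightarrow> stored \<alpha>c \<alpha>d s1 \<pi> d (Suc k) + \<alpha>c * C - 1 / \<alpha>d * D)"

definition action ::
  "real \<Rightarrow> real \<Rightarrow> real \<Rightarrow> policy \<Rightarrow> (nat \<Rightarrow> real) \<Rightarrow> nat \<Rightarrow> real \<times> real \<times> real" where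
  "action \<alpha>c \<alpha>d s1 \<pi> d i =
     \<pi> i (\<lambda>j\<in>{1..i}. stored \<alpha>c \<alpha>d s1 \<pi> d j, \<lambda>j\<in>{1..i}. d j)"

definition generation ::
  "real \<Rightarrow> real \<Rightarrow> real \<Rightarrow> policy \<Rightarrow> (nat \<Rightarrow> real) \<Rightarrow> nat \<Rightarrow> real" where
  "generation \<alpha>c \<alpha>d s1 \<pi> d i = fst (action \<alpha>c \<alpha>d s1 \<pi> d i)"

definition feasible :: "real \<Rightarrow> real \<Rightarrow> real \<Rightarrow> real \<Rightarrow> real \<Rightarrow> real \<times> real \<times> real \<Rightarrow> bool" where
  "feasible \<alpha>d Gmax Smax s x = (\<lambda>(G, C, D).
     0 \<le> s \<and> s \<le> Smax \<and> 0 \<le> C \<and> 0 \<le> D \<and> 0 \<le> G \<and> G \<le> Gmax \<and>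
     0 \<le> G - C + D + max x (- Gmax - \<alpha>d * s))"

text \<open>
  The storage dynamics are built into \<^const>\<open>stored\<close>; the remaining constraints are
  imposed almost surely.
\<close>

definition admissible ::
  "'a measure \<Rightarrow> (nat \<Rightarrow> 'a \<Rightarrow> real) \<Rightarrow> real \<Rightarrow> real \<Rightarrow> real \<Rightarrow> real \<Rightarrow> real \<Rightarrow> policy \<Rightarrow> bool" where
  "admissible M \<Delta> \<alpha>c \<alpha>d Gmax Smax s1 \<pi> \<longleftrightarrow>
     (\<forall>i\<ge>1. \<pi> i \<in> borel_measurable
        ((\<Pi>\<^sub>M j\<in>{1..i}. borel) \<Otimes>\<^sub>M (\<Pi>\<^sub>M j\<in>{1..i}. borel))) \<and>
     (AE \<omega> in M. \<forall>i\<ge>1.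
        feasible \<alpha>d Gmax Smax (stored \<alpha>c \<alpha>d s1 \<pi> (\<lambda>j. \<Delta> j \<omega>) i) (\<Delta> i \<omega>)
          (action \<alpha>c \<alpha>d s1 \<pi> (\<lambda>j. \<Delta> j \<omega>) i))"

definition avg_generation ::
  "'a measure \<Rightarrow> (nat \<Rightarrow> 'a \<Rightarrow> real) \<Rightarrow> real \<Rightarrow> real \<Rightarrow> real \<Rightarrow> policy \<Rightarrow> ereal" where
  "avg_generation M \<Delta> \<alpha>c \<alpha>d s1 \<pi> =
     limsup (\<lambda>n. ereal (integral\<^sup>L M
       (\<lambda>\<omega>. 1 / real n * (\<Sum>i=1..n. generation \<alpha>c \<alpha>d s1 \<pi> (\<lambda>j. \<Delta> j \<omega>) i))))"

definition greedy_policy :: "real \<Rightarrow> real \<Rightarrow> real \<Rightarrow> real \<Rightarrow> policy" where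
  "greedy_policy \<alpha>c \<alpha>d Gmax Smax i = (\<lambda>(S, d).
     if (Smax - S i) / \<alpha>c \<le> d i then (0, (Smax - S i) / \<alpha>c, 0)
     else if 0 \<le> d i then (0, d i, 0)
     else if - \<alpha>d * S i \<le> d i then (0, 0, - d i)
     else if - Gmax - \<alpha>d * S i \<le> d i then (- d i - \<alpha>d * S i, 0, \<alpha>d * S i)
     else (Gmax, 0, \<alpha>d * S i))"

end

theory Submission
  imports Defs
begin

text \<open>
  The average-cost optimality equation
  \<open>E[G + h(s')] = J + h(s)\<close> for the greedy policy has an explicit solution: differentiating it
  twice in \<open>s\<close> gives a linear ODE with constant coefficients, hence \<open>h\<close> is an affine function
  plus an exponential. On \<open>[0, Smax]\<close> its slope lies in \<open>[-\<alpha>d, 0]\<close>, that is, a unit of stored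
  power is never worth more than the \<open>\<alpha>d\<close> units of generation it replaces. Therefore every feasible
  action satisfies \<open>G + h(s') \<ge> G\<^sup>g + h(s\<^sup>g)\<close>, where \<open>G\<^sup>g\<close> and \<open>s\<^sup>g\<close> are the greedy generation
  and the greedy next level. As \<open>\<Delta>\<^sub>i\<close> is independent of \<open>S\<^sub>i\<close>, taking expectations and
  telescoping the bounded terms \<open>E[h(S\<^sub>i)]\<close> gives cost at least \<open>J\<close> for every policy, with equality
  for the greedy one.
\<close>

section \<open>The average-cost optimality equation\<close>

text \<open>Zero extension moves the claim to the whole line, where the integral is a limit over
  boxes. A box around a ball centred at 0 still contains that ball after negation, so reflection on
  boxes suffices.\<close>

lemma has_integral_reflect_image:
  fixes f :: "real \<Rightarrow> real"
  assumes "((\<lambda>x. f (- x)) has_integral i) S"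
  shows "(f has_integral i) (uminus ` S)"
proof -
  define g where "g x = (if - x \<in> S then f x else 0)" for x
  have H: "((\<lambda>x. g (- x)) has_integral i) UNIV"
    using assms unfolding g_def by (subst (asm) has_integral_restrict_UNIV[symmetric]) simp
  have "(g has_integral i) UNIV"
  proof (rule has_integral'[THEN iffD2], intro allI impI)
    fix e :: real assume "0 < e"
    from H[THEN has_integral'[THEN iffD1], rule_format, OF this]
    obtain B where B: "0 < B" "\<And>a b. ball 0 B \<subseteq> cbox a b \<Longrightarrow>
        \<exists>z. ((\<lambda>x. if x \<in> UNIV then g (- x) else 0) has_integral z) (cbox a b) \<and> norm (z - i) < e"
      by blast
    have "\<exists>z. ((\<lambda>x. if x \<in> UNIV then g x else 0) has_integral z) (cbox a b) \<and> norm (z - i) < e"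
      if "ball 0 B \<subseteq> cbox a b" for a b
    proof -
      have "ball 0 B \<subseteq> cbox (- b) (- a)"
      proof
        fix x :: real assume "x \<in> ball 0 B"
        hence "- x \<in> ball 0 B" by simp
        hence "- x \<in> cbox a b" using that by blast
        thus "x \<in> cbox (- b) (- a)" by auto
      qed
      from B(2)[OF this] show ?thesis by simp
    qed
    thus "\<exists>B>0. \<forall>a b. ball 0 B \<subseteq> cbox a b \<longrightarrow>
        (\<exists>z. ((\<lambda>x. if x \<in> UNIV then g x else 0) has_integral z) (cbox a b) \<and> norm (z - i) < e)"
      using B(1) by blast
  qed
  moreover have "g = (\<lambda>x. if x \<in> uminus ` S then f x else 0)"
    by (force simp: g_def image_iff)
  ultimately show ?thesis using has_integral_restrict_UNIV by metis
qed

lemma has_integral_Icc_Ici: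
  fixes f :: "real \<Rightarrow> real"
  assumes "(f has_integral i) {a..b}" "(f has_integral j) {b..}" "a \<le> b"
  shows "(f has_integral (i + j)) {a..}"
proof -
  have "{a..} = {a..b} \<union> {b..}" "{a..b} \<inter> {b..} = {b}" using assms(3) by auto
  thus ?thesis using has_integral_Un[OF assms(1,2)] by simp
qed

section \<open>Explicit solution of the optimality equation\<close>

locale storage_system =
  fixes \<alpha>c \<alpha>d Gmax Smax l :: real
  assumes ac: "0 < \<alpha>c" "\<alpha>c < 1" and ad: "0 < \<alpha>d" "\<alpha>d < 1"
    and Gmax: "0 \<le> Gmax" and Smax: "0 \<le> Smax" and l: "0 < l"
begin

text \<open>Given its sign, the error has an exponential modulus of rate \<open>l\<close>. Before
  truncation, the upward or downward step of the level is then exponential of rate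
  \<open>up_rate\<close> or \<open>down_rate\<close>.\<close>

definition up_rate :: real where "up_rate = l / \<alpha>c"
definition down_rate :: real where "down_rate = l * \<alpha>d"

text \<open>The nonzero characteristic exponent of the ODE for \<open>bias\<close>.\<close>

definition kappa :: real where "kappa = (up_rate - down_rate) / 2"

text \<open>The value for which the boundary condition \<open>down_part_0\<close> of an empty
  storage holds; \<open>opt_cost_eq\<close> rewrites it in terms of the efficiencies.\<close>

definition opt_cost :: real where
  "opt_cost = (1 - exp (- l * Gmax)) / (2 * l) * (up_rate - down_rate) /
     (up_rate - down_rate * exp (- kappa * Smax))"

definition slope_coeff :: real where
  "slope_coeff = 2 * down_rate * opt_cost / (up_rate - down_rate)"

text \<open>The affine part has the slope whose product with the mean step
  \<open>(1 / up_rate - 1 / down_rate) / 2\<close> is \<open>opt_cost\<close>. The factor of the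
  exponential is the one for which the expected change after a surplus vanishes at
  \<open>Smax\<close>. The additive constant is set to zero, as only differences of the bias
  matter.\<close>

definition bias :: "real \<Rightarrow> real" where
  "bias s = - slope_coeff * (up_rate * s -
     (up_rate + down_rate) / (up_rate - down_rate) * exp (kappa * (s - Smax)))"

definition bias_slope :: "real \<Rightarrow> real" where
  "bias_slope s = - slope_coeff * (up_rate -
     (up_rate + down_rate) / 2 * exp (kappa * (s - Smax)))"

text \<open>
  Conditionally on \<open>\<Delta> > 0\<close>, the greedy policy generates nothing and the expected bias of the next
  level is \<open>bias s + up_part s\<close>; conditionally on \<open>\<Delta> < 0\<close>, generation plus bias of the next level has
  expectation \<open>down_part s\<close>. The definitions are such that the average of the two is \<open>opt_cost + bias s\<close>.
\<close>

definition up_part :: "real \<Rightarrow> real" where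
  "up_part s = slope_coeff * (exp (kappa * (s - Smax)) - 1)"

definition down_part :: "real \<Rightarrow> real" where
  "down_part s = bias s - up_part s + 2 * opt_cost"

text \<open>Concave with a kink at 0, since \<alpha>c < 1 < 1 / \<alpha>d: a unit delivered costs
  more storage than a unit charged returns.\<close>

definition gain :: "real \<Rightarrow> real" where
  "gain x = (if 0 \<le> x then \<alpha>c * x else x / \<alpha>d)"

text \<open>\<open>greedy_gen\<close> and \<open>greedy_next\<close> express the five cases of the
  policy as truncations; \<open>greedy_policy_slot\<close> shows the agreement.\<close>

definition greedy_gen :: "real \<Rightarrow> real \<Rightarrow> real" where
  "greedy_gen s x = min Gmax (max 0 (- x - \<alpha>d * s))"

definition greedy_next :: "real \<Rightarrow> real \<Rightarrow> real" where
  "greedy_next s x = max 0 (min Smax (s + gain x))"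

definition bellman :: "real \<Rightarrow> real \<Rightarrow> real" where
  "bellman s x = greedy_gen s x + bias (greedy_next s x)"

section \<open>Signs of the constants and slope of the bias\<close>

lemma down_less_up: "down_rate < up_rate" and down_pos: "0 < down_rate"
proof -
  \<comment> \<open>The quotient \<open>down_rate / up_rate\<close> is the round-trip efficiency, so
    the loss of a round trip separates the two rates.\<close>
  have "\<alpha>d * \<alpha>c < 1" using ac ad by (smt (verit) mult_less_cancel_left2)
  hence "\<alpha>d < 1 / \<alpha>c" using ac by (simp add: field_simps)
  thus "down_rate < up_rate" using l unfolding down_rate_def up_rate_def
    by (metis mult_strict_left_mono times_divide_eq_right mult.right_neutral)
  show "0 < down_rate" using l ad by (simp add: down_rate_def)
qed

lemma kappa_pos: "0 < kappa"
  using down_less_up by (simp add: kappa_def)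

lemma denominator_pos: "0 < up_rate - down_rate * exp (- kappa * Smax)"
proof -
  have "exp (- kappa * Smax) \<le> 1" using kappa_pos Smax by simp
  hence "down_rate * exp (- kappa * Smax) \<le> down_rate" using down_pos by simp
  thus ?thesis using down_less_up by linarith
qed

lemma opt_cost_nonneg: "0 \<le> opt_cost"
  unfolding opt_cost_def using l Gmax denominator_pos down_less_up by simp

lemma slope_coeff_nonneg: "0 \<le> slope_coeff"
  unfolding slope_coeff_def using opt_cost_nonneg down_pos down_less_up by simp

text \<open>The second factor is the denominator of \<open>opt_cost\<close> and cancels, which
  leaves \<open>\<alpha>d * (1 - exp (- l * Gmax))\<close>.\<close>

lemma slope_coeff_bound:
  "slope_coeff * (up_rate - down_rate * exp (- kappa * Smax)) \<le> \<alpha>d"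
proof -
  have "slope_coeff * (up_rate - down_rate * exp (- kappa * Smax)) =
      2 * down_rate * ((1 - exp (- l * Gmax)) / (2 * l))"
    unfolding slope_coeff_def opt_cost_def
    using denominator_pos down_less_up by simp
  also have "\<dots> = \<alpha>d * (1 - exp (- l * Gmax))"
    using l by (simp add: down_rate_def field_simps)
  also have "\<dots> \<le> \<alpha>d" using ad by simp
  finally show ?thesis .
qed

lemma bias_deriv: "(bias has_real_derivative bias_slope s) (at s within A)"
proof -
  have "(up_rate + down_rate) / (up_rate - down_rate) * kappa = (up_rate + down_rate) / 2"
    unfolding kappa_def using down_less_up by simp
  hence "(up_rate + down_rate) / (up_rate - down_rate) * (exp (kappa * (s - Smax)) * kappa) =
      (up_rate + down_rate) / 2 * exp (kappa * (s - Smax))" by algebra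
  hence "bias_slope s = - slope_coeff * (up_rate -
      (up_rate + down_rate) / (up_rate - down_rate) * (exp (kappa * (s - Smax)) * kappa))"
    unfolding bias_slope_def by simp
  thus ?thesis unfolding bias_def
    by (simp only:) (rule derivative_eq_intros refl | simp)+
qed

lemma up_part_deriv:
  "(up_part has_real_derivative slope_coeff * kappa * exp (kappa * (s - Smax))) (at s within A)"
  unfolding up_part_def by (auto intro!: derivative_eq_intros)

text \<open>The bracket in \<open>bias_slope\<close> decreases in the exponential, which lies
  between \<open>exp (- kappa * Smax)\<close> and 1. At 1 the bracket is half the difference of the
  rates, whence the sign.\<close>

lemma bias_slope_bounds:
  assumes "0 \<le> s" "s \<le> Smax"
  shows "- \<alpha>d \<le> bias_slope s" "bias_slope s \<le> 0"
proof -
  let ?e = "exp (- kappa * Smax)" and ?E = "exp (kappa * (s - Smax))"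
  have "?E \<le> 1" using assms kappa_pos by (simp add: mult_nonneg_nonpos)
  hence "(up_rate + down_rate) / 2 * ?E \<le> (up_rate + down_rate) / 2"
    using down_pos down_less_up by (intro mult_left_le) auto
  hence "0 \<le> up_rate - (up_rate + down_rate) / 2 * ?E" using down_less_up by argo
  thus "bias_slope s \<le> 0" using slope_coeff_nonneg by (simp add: bias_slope_def mult_nonneg_nonneg)
  have "- kappa * Smax \<le> kappa * (s - Smax)" using assms kappa_pos by (simp add: right_diff_distrib)
  hence "?e \<le> ?E" by simp
  hence "(up_rate + down_rate) / 2 * ?e \<le> (up_rate + down_rate) / 2 * ?E"
    using down_pos down_less_up by (intro mult_left_mono) auto
  \<comment> \<open>Replacing the mean of the rates by the smaller \<open>down_rate\<close> produces
    the denominator of \<open>opt_cost\<close>, as \<open>slope_coeff_bound\<close>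
    requires.\<close>
  moreover have "down_rate * ?e \<le> (up_rate + down_rate) / 2 * ?e"
    using down_less_up by (intro mult_right_mono) auto
  ultimately have "up_rate - (up_rate + down_rate) / 2 * ?E \<le> up_rate - down_rate * ?e" by linarith
  from mult_left_mono[OF this slope_coeff_nonneg] slope_coeff_bound
  show "- \<alpha>d \<le> bias_slope s" by (simp add: bias_slope_def)
qed

lemma bias_antimono:
  assumes "0 \<le> s" "s \<le> t" "t \<le> Smax"
  shows "bias t \<le> bias s"
proof (rule DERIV_nonpos_imp_nonincreasing[OF assms(2)])
  fix x assume "s \<le> x" "x \<le> t"
  thus "\<exists>y. (bias has_real_derivative y) (at x) \<and> y \<le> 0"
    using bias_slope_bounds(2)[of x] bias_deriv[of x UNIV] assms by auto
qed

lemma bias_lipschitz: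
  assumes "0 \<le> s" "s \<le> t" "t \<le> Smax"
  shows "bias s - bias t \<le> \<alpha>d * (t - s)"
proof -
  have "bias s + \<alpha>d * s \<le> bias t + \<alpha>d * t"
  proof (rule DERIV_nonneg_imp_nondecreasing[OF assms(2)])
    fix x assume "s \<le> x" "x \<le> t"
    hence "0 \<le> bias_slope x + \<alpha>d" using bias_slope_bounds(1)[of x] assms by linarith
    thus "\<exists>y. ((\<lambda>x. bias x + \<alpha>d * x) has_real_derivative y) (at x) \<and> 0 \<le> y"
      by (intro exI[of _ "bias_slope x + \<alpha>d"])
         (auto intro!: derivative_eq_intros bias_deriv)
  qed
  thus ?thesis by (simp add: algebra_simps)
qed

section \<open>One-slot comparison with the greedy action\<close>

lemma gain_le: "\<alpha>c * C - 1 / \<alpha>d * D \<le> gain (C - D)" if "0 \<le> C" "0 \<le> D"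
proof -
  \<comment> \<open>Netting charge against discharge never lowers the level: a unit done both ways
    adds \<alpha>c and removes 1 / \<alpha>d.\<close>
  have le: "\<alpha>c \<le> 1 / \<alpha>d" using ac ad by (simp add: field_simps mult_le_one)
  show ?thesis
  proof (cases "D \<le> C")
    case True
    thus ?thesis using mult_right_mono[OF le that(2)] by (simp add: gain_def algebra_simps)
  next
    case False
    thus ?thesis using mult_right_mono[OF le that(1)] by (simp add: gain_def diff_divide_distrib)
  qed
qed

lemma gain_lipschitz: "gain y - gain x \<le> (y - x) / \<alpha>d" if "x \<le> y"
proof -
  have le: "\<alpha>c \<le> 1 / \<alpha>d" using ac ad by (simp add: field_simps mult_le_one)
  have *: "\<alpha>c * z \<le> z / \<alpha>d" if "0 \<le> z" for z using mult_right_mono[OF le that] by simp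
  show ?thesis using *[of y] *[of "y - x"] that
    by (auto simp: gain_def diff_divide_distrib algebra_simps)
qed

lemma gain_mono: "x \<le> y \<Longrightarrow> gain x \<le> gain y"
  using ac ad by (auto simp: gain_def divide_right_mono)
    (smt (verit) divide_nonpos_pos mult_nonneg_nonneg)

text \<open>Generation in excess of the greedy amount lifts the level above the greedy one by at
  most the excess over \<alpha>d, and the bias falls by at most \<alpha>d per unit of level, so the
  excess never pays. A lower level only raises the bias.\<close>

lemma bellman_le:
  assumes f: "feasible \<alpha>d Gmax Smax s x (G, C, D)"
    and s': "s' = s + \<alpha>c * C - 1 / \<alpha>d * D" "0 \<le> s'" "s' \<le> Smax"
  shows "bellman s x \<le> G + bias s'"
proof -
  \<comment> \<open>\<open>z\<close> is the error after unavoidable load shedding; the balance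
    constraint becomes \<open>C - D \<le> G + z\<close>.\<close>
  define z where "z = max x (- Gmax - \<alpha>d * s)"
  define g where "g = greedy_gen s x"
  define t where "t = greedy_next s x"
  have b: "0 \<le> s" "s \<le> Smax" "0 \<le> C" "0 \<le> D" "0 \<le> G" "G \<le> Gmax" "0 \<le> G - C + D + z"
    using f by (auto simp: feasible_def z_def)
  have ads: "0 \<le> \<alpha>d * s" using ad b by simp
  have g_eq: "g = max 0 (- z - \<alpha>d * s)" using Gmax ads by (auto simp: g_def greedy_gen_def z_def)
  have bound: "s' \<le> s + gain (G + z)"
    using gain_le[OF b(3,4)] gain_mono[of "C - D" "G + z"] b s' by linarith
  \<comment> \<open>With less generation than \<open>g\<close>, covering the deficit
    \<open>z\<close> would push the level below 0.\<close>
  have gG: "g \<le> G"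
  proof (rule ccontr)
    assume "\<not> g \<le> G"
    hence *: "G + z < - \<alpha>d * s" using b g_eq by (auto simp: max_def split: if_splits)
    hence "gain (G + z) = (G + z) / \<alpha>d" using ads by (simp add: gain_def)
    also have "\<dots> < - \<alpha>d * s / \<alpha>d" using * ad by (intro divide_strict_right_mono) auto
    also have "\<dots> = - s" using ad by simp
    finally show False using bound s' by linarith
  qed
  have t_eq: "t = min Smax (s + gain (g + z))"
  proof (cases "x < - \<alpha>d * s")
    case True
    \<comment> \<open>In a shortage the greedy generation leaves exactly the stored power to be
      discharged, which matches the truncation of \<open>greedy_next\<close> at 0.\<close>
    hence gz: "g + z = - \<alpha>d * s" using g_eq Gmax by (auto simp: z_def)
    have *: "gain (- \<alpha>d * s) = - s" using ad ads by (auto simp: gain_def)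
    hence "gain x \<le> - s" using gain_mono[of x "- \<alpha>d * s"] True by simp
    thus ?thesis using Smax * unfolding gz by (auto simp: t_def greedy_next_def)
  next
    case False
    hence "x = z" "g = 0" using g_eq Gmax by (auto simp: z_def)
    moreover have "- s \<le> gain x"
      using False gain_mono[of "- \<alpha>d * s" x] ad ads
      by (auto simp: gain_def split: if_splits)
    ultimately show ?thesis using Smax by (auto simp: t_def greedy_next_def)
  qed
  have t: "0 \<le> t" "t \<le> Smax" using Smax by (auto simp: t_def greedy_next_def)
  have "bias t - bias s' \<le> G - g"
  proof (cases "s' \<le> t")
    case True
    thus ?thesis using bias_antimono[of s' t] s' t gG by linarith
  next
    case False
    \<comment> \<open>Here \<open>t < s' \<le> Smax\<close>, so the cap at \<open>Smax\<close> in
      \<open>t_eq\<close> is inactive.\<close>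
    have "s' - t \<le> gain (G + z) - gain (g + z)" using False t_eq bound s' by auto
    also have "\<dots> \<le> (G - g) / \<alpha>d" using gain_lipschitz[of "g + z" "G + z"] gG by simp
    finally have "\<alpha>d * (s' - t) \<le> G - g" using ad by (simp add: field_simps)
    thus ?thesis using bias_lipschitz[of t s'] False s' t by linarith
  qed
  thus ?thesis by (simp add: bellman_def g_def t_def)
qed

section \<open>The optimality equation integrated against the Laplace density\<close>

lemma up_part_Smax: "up_part Smax = 0"
  by (simp add: up_part_def)

text \<open>Boundary condition at an empty storage: \<open>(1 - exp (- l * Gmax)) / l\<close> is the
  mean of an exponential deficit of rate \<open>l\<close> capped at \<open>Gmax\<close>.\<close>

lemma down_part_0: "down_part 0 = bias 0 + (1 - exp (- l * Gmax)) / l"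
proof -
  let ?e = "exp (- kappa * Smax)"
  have "opt_cost * (up_rate - down_rate * ?e) = (1 - exp (- l * Gmax)) / (2 * l) * (up_rate - down_rate)"
    unfolding opt_cost_def using denominator_pos by simp
  moreover have "slope_coeff * (up_rate - down_rate) = 2 * down_rate * opt_cost"
    unfolding slope_coeff_def using down_less_up by simp
  ultimately have "(2 * opt_cost - slope_coeff * (?e - 1)) * (up_rate - down_rate) =
      2 * ((1 - exp (- l * Gmax)) / (2 * l)) * (up_rate - down_rate)"
    by algebra
  hence "2 * opt_cost - slope_coeff * (?e - 1) = 2 * ((1 - exp (- l * Gmax)) / (2 * l))"
    using down_less_up mult_right_cancel[of "up_rate - down_rate"] by fastforce
  also have "\<dots> = (1 - exp (- l * Gmax)) / l" using l by (simp add: divide_simps)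
  finally show ?thesis by (simp add: down_part_def up_part_def)
qed

text \<open>With \<open>U = bias + up_part\<close>, this is the equation
  \<open>U' = up_rate * (U - bias)\<close> of the mean bias after an exponential upward step;
  \<open>down_part_deriv\<close> is its mirror image.\<close>

lemma bias_up_deriv:
  "((\<lambda>s. bias s + up_part s) has_real_derivative up_rate * up_part s) (at s within A)"
proof -
  have "bias_slope s + slope_coeff * kappa * exp (kappa * (s - Smax)) = up_rate * up_part s"
    by (simp add: bias_slope_def up_part_def kappa_def field_simps)
  thus ?thesis using DERIV_add[OF bias_deriv up_part_deriv] by metis
qed

lemma down_part_deriv:
  "(down_part has_real_derivative down_rate * (bias s - down_part s)) (at s within A)"
proof -
  have "2 * down_rate * opt_cost = slope_coeff * (up_rate - down_rate)"
    unfolding slope_coeff_def using down_less_up by simp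
  hence "down_rate * (up_part s - 2 * opt_cost) = bias_slope s - slope_coeff * kappa * exp (kappa * (s - Smax))"
    by (simp add: bias_slope_def up_part_def kappa_def field_simps)
  thus ?thesis unfolding down_part_def
    by (auto intro!: derivative_eq_intros bias_deriv up_part_deriv)
qed

lemma has_integral_exp_tail: "((\<lambda>x. l * exp (- l * x) * c) has_integral exp (- l * t) * c) {t..}"
  using has_integral_mult_left[OF has_integral_exp_minus_to_infinity[OF l, of t], of "l * c"] l
  by (simp add: mult_ac)

text \<open>Integrating factor: if \<open>V' = l * (V - h)\<close>, then
  \<open>- exp (- l * x) * V x\<close> is an antiderivative of
  \<open>l * exp (- l * x) * h x\<close>. Here \<open>D\<close> stands for
  \<open>V - h\<close>.\<close>

lemma exp_mult_deriv:
  assumes "(V has_real_derivative l * D) (at x within A)"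
  shows "((\<lambda>x. - exp (- l * x) * V x) has_real_derivative l * exp (- l * x) * (V x - D)) (at x within A)"
  by (rule derivative_eq_intros refl assms)+ (simp add: algebra_simps)

text \<open>\<open>T\<close> is the surplus that fills the storage. Up to \<open>T\<close> the
  integrand has the antiderivative \<open>F\<close>; beyond it the bias is constant, and this tail
  cancels \<open>F T\<close> because \<open>up_part Smax\<close> is 0.\<close>

lemma has_integral_bellman_up:
  assumes "0 \<le> s" "s \<le> Smax"
  shows "((\<lambda>x. l * exp (- l * x) * bellman s x) has_integral bias s + up_part s) {0..}"
proof -
  define T where "T = (Smax - s) / \<alpha>c"
  define F where "F x = - exp (- l * x) * (bias (s + \<alpha>c * x) + up_part (s + \<alpha>c * x))" for x
  have T: "0 \<le> T" "\<alpha>c * T = Smax - s" using assms ac by (auto simp: T_def)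
  have g0: "greedy_gen s x = 0" if "0 \<le> x" for x
  proof -
    have "0 \<le> \<alpha>d * s" using assms ad by simp
    thus ?thesis using that Gmax by (simp add: greedy_gen_def)
  qed
  have low: "bellman s x = bias (s + \<alpha>c * x)" if "x \<in> {0..T}" for x
  proof -
    have "\<alpha>c * x \<le> \<alpha>c * T" "0 \<le> \<alpha>c * x" using that ac by auto
    hence "greedy_next s x = s + \<alpha>c * x" using that T assms
      by (simp add: greedy_next_def gain_def)
    thus ?thesis using that g0 by (simp add: bellman_def)
  qed
  have high: "bellman s x = bias Smax" if "x \<in> {T..}" for x
  proof -
    have "\<alpha>c * T \<le> \<alpha>c * x" using that ac by auto
    hence "greedy_next s x = Smax" using that T Smax by (simp add: greedy_next_def gain_def)
    thus ?thesis using that T g0 by (simp add: bellman_def)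
  qed
  have "((\<lambda>x. l * exp (- l * x) * bias (s + \<alpha>c * x)) has_integral F T - F 0) {0..T}"
  proof (rule fundamental_theorem_of_calculus[OF T(1)])
    fix x
    have "((\<lambda>x. bias (s + \<alpha>c * x) + up_part (s + \<alpha>c * x)) has_real_derivative
        up_rate * up_part (s + \<alpha>c * x) * \<alpha>c) (at x within {0..T})"
      by (rule DERIV_chain2[OF bias_up_deriv]) (auto intro!: derivative_eq_intros)
    moreover have "up_rate * up_part (s + \<alpha>c * x) * \<alpha>c = l * up_part (s + \<alpha>c * x)"
      using ac by (simp add: up_rate_def)
    ultimately have "((\<lambda>x. bias (s + \<alpha>c * x) + up_part (s + \<alpha>c * x)) has_real_derivative
        l * up_part (s + \<alpha>c * x)) (at x within {0..T})" by metis
    from exp_mult_deriv[OF this]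
    have "(F has_real_derivative l * exp (- l * x) * bias (s + \<alpha>c * x)) (at x within {0..T})"
      unfolding F_def by simp
    thus "(F has_vector_derivative l * exp (- l * x) * bias (s + \<alpha>c * x)) (at x within {0..T})"
      by (simp add: has_real_derivative_iff_has_vector_derivative)
  qed
  hence 1: "((\<lambda>x. l * exp (- l * x) * bellman s x) has_integral F T - F 0) {0..T}"
    by (rule has_integral_eq[rotated]) (simp add: low)
  have 2: "((\<lambda>x. l * exp (- l * x) * bellman s x) has_integral exp (- l * T) * bias Smax) {T..}"
    by (rule has_integral_eq[OF _ has_integral_exp_tail]) (simp add: high)
  have "F T - F 0 + exp (- l * T) * bias Smax = bias s + up_part s"
    using T by (simp add: F_def up_part_Smax)
  with has_integral_Icc_Ici[OF 1 2 T(1)] show ?thesis by metis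
qed

text \<open>A deficit is served by storage alone up to \<open>T\<close>, by additional generation up
  to \<open>T + Gmax\<close>, and only in part beyond. The last two ranges cancel \<open>F T\<close>
  by \<open>down_part_0\<close>.\<close>

lemma has_integral_bellman_down:
  assumes "0 \<le> s" "s \<le> Smax"
  shows "((\<lambda>x. l * exp (- l * x) * bellman s (- x)) has_integral down_part s) {0..}"
proof -
  define T where "T = \<alpha>d * s"
  define F where "F x = - exp (- l * x) * down_part (s - x / \<alpha>d)" for x
  \<comment> \<open>For an affine \<open>h\<close> of slope 1, \<open>V = h + 1 / l\<close> solves
    \<open>V' = l * (V - h)\<close>.\<close>
  define H where "H x = - exp (- l * x) * (x - T + 1 / l + bias 0)" for x
  have T: "0 \<le> T" "T / \<alpha>d = s" using assms ad by (auto simp: T_def)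
  have gain: "gain (- x) = - x / \<alpha>d" if "0 \<le> x" for x
    using that by (auto simp: gain_def)
  have low: "bellman s (- x) = bias (s - x / \<alpha>d)" if "x \<in> {0..T}" for x
  proof -
    have "x / \<alpha>d \<le> s" "0 \<le> x / \<alpha>d" using that ad by (auto simp: T_def field_simps)
    thus ?thesis using that T_def Gmax assms
      by (auto simp: bellman_def greedy_next_def greedy_gen_def gain)
  qed
  have next0: "greedy_next s (- x) = 0" if "T \<le> x" for x
  proof -
    have "s \<le> x / \<alpha>d" using that ad by (simp add: T_def field_simps)
    thus ?thesis using that T assms by (simp add: greedy_next_def gain)
  qed
  have mid: "bellman s (- x) = x - T + bias 0" if "x \<in> {T..T + Gmax}" for x
    using that next0 by (auto simp: bellman_def greedy_gen_def T_def)
  have high: "bellman s (- x) = Gmax + bias 0" if "x \<in> {T + Gmax..}" for x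
    using that next0 Gmax by (auto simp: bellman_def greedy_gen_def T_def)
  have "((\<lambda>x. l * exp (- l * x) * bias (s - x / \<alpha>d)) has_integral F T - F 0) {0..T}"
  proof (rule fundamental_theorem_of_calculus[OF T(1)])
    fix x
    let ?u = "s - x / \<alpha>d"
    have "((\<lambda>x. down_part (s - x / \<alpha>d)) has_real_derivative
        down_rate * (bias ?u - down_part ?u) * (- 1 / \<alpha>d)) (at x within {0..T})"
      by (rule DERIV_chain2[OF down_part_deriv]) (use ad in \<open>auto intro!: derivative_eq_intros\<close>)
    moreover have "down_rate * (bias ?u - down_part ?u) * (- 1 / \<alpha>d) = l * (down_part ?u - bias ?u)"
      using ad by (simp add: down_rate_def field_simps)
    ultimately have "((\<lambda>x. down_part (s - x / \<alpha>d)) has_real_derivative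
        l * (down_part ?u - bias ?u)) (at x within {0..T})" by metis
    from exp_mult_deriv[OF this]
    have "(F has_real_derivative l * exp (- l * x) * bias ?u) (at x within {0..T})"
      unfolding F_def by simp
    thus "(F has_vector_derivative l * exp (- l * x) * bias ?u) (at x within {0..T})"
      by (simp add: has_real_derivative_iff_has_vector_derivative)
  qed
  hence 1: "((\<lambda>x. l * exp (- l * x) * bellman s (- x)) has_integral F T - F 0) {0..T}"
    by (rule has_integral_eq[rotated]) (simp add: low)
  have "((\<lambda>x. l * exp (- l * x) * (x - T + bias 0)) has_integral H (T + Gmax) - H T) {T..T + Gmax}"
  proof (rule fundamental_theorem_of_calculus)
    fix x
    have "(H has_real_derivative l * exp (- l * x) * (x - T + bias 0)) (at x within {T..T + Gmax})"
      unfolding H_def using l by (auto intro!: derivative_eq_intros simp: field_simps)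
    thus "(H has_vector_derivative l * exp (- l * x) * (x - T + bias 0)) (at x within {T..T + Gmax})"
      by (simp add: has_real_derivative_iff_has_vector_derivative)
  qed (use Gmax in simp)
  hence 2: "((\<lambda>x. l * exp (- l * x) * bellman s (- x)) has_integral H (T + Gmax) - H T) {T..T + Gmax}"
    by (rule has_integral_eq[rotated]) (simp add: mid)
  have 3: "((\<lambda>x. l * exp (- l * x) * bellman s (- x)) has_integral
      exp (- l * (T + Gmax)) * (Gmax + bias 0)) {T + Gmax..}"
    by (rule has_integral_eq[OF _ has_integral_exp_tail]) (simp add: high)
  have "exp (- l * (T + Gmax)) = exp (- l * T) * exp (- l * Gmax)"
    by (simp add: exp_add[symmetric] algebra_simps)
  hence "F T - F 0 + (H (T + Gmax) - H T + exp (- l * (T + Gmax)) * (Gmax + bias 0)) = down_part s"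
    using T l by (simp add: F_def H_def down_part_0 field_simps)
  moreover have "T \<le> T + Gmax" using Gmax by simp
  ultimately show ?thesis using has_integral_Icc_Ici[OF 1 has_integral_Icc_Ici[OF 2 3] T(1)] by metis
qed

lemma has_integral_bellman:
  assumes "0 \<le> s" "s \<le> Smax"
  shows "((\<lambda>x. laplace_density l x * bellman s x) has_integral opt_cost + bias s) UNIV"
proof -
  let ?f = "\<lambda>x. laplace_density l x * bellman s x"
  have 1: "(?f has_integral (bias s + up_part s) / 2) {0..}"
    by (rule has_integral_eq[OF _ has_integral_divide[OF has_integral_bellman_up[OF assms], of 2]])
       (simp add: laplace_density_def)
  have "((\<lambda>x. ?f (- x)) has_integral down_part s / 2) {0..}"
    by (rule has_integral_eq[OF _ has_integral_divide[OF has_integral_bellman_down[OF assms], of 2]])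
       (simp add: laplace_density_def)
  hence "(?f has_integral down_part s / 2) (uminus ` {0..})"
    by (rule has_integral_reflect_image)
  hence 2: "(?f has_integral down_part s / 2) {..0}" by simp
  have "{0..} \<union> {..0} = (UNIV :: real set)" "{0..} \<inter> {..0} = {0::real}" by auto
  hence "(?f has_integral (bias s + up_part s) / 2 + down_part s / 2) UNIV"
    using has_integral_Un[OF 1 2] by simp
  moreover have "(bias s + up_part s) / 2 + down_part s / 2 = opt_cost + bias s"
    by (simp add: down_part_def field_simps)
  ultimately show ?thesis by metis
qed

end

section \<open>Stored power under a policy\<close>

text \<open>By independence the joint law is the product of the marginals, and Fubini integrates
  \<open>Y\<close> out with \<open>X\<close> frozen. The uniform bound supplies
  integrability.\<close>

lemma (in prob_space) indep_var_expectation: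
  fixes f :: "'b \<times> 'b \<Rightarrow> real"
  assumes ind: "indep_var S X T Y" and f: "f \<in> borel_measurable (S \<Otimes>\<^sub>M T)"
    and bound: "\<And>z. \<bar>f z\<bar> \<le> B"
  shows "expectation (\<lambda>\<omega>. f (X \<omega>, Y \<omega>)) = expectation (\<lambda>\<omega>. expectation (\<lambda>\<omega>'. f (X \<omega>, Y \<omega>')))"
proof -
  have X[measurable]: "X \<in> measurable M S" and Y[measurable]: "Y \<in> measurable M T"
    and eq: "distr M S X \<Otimes>\<^sub>M distr M T Y = distr M (S \<Otimes>\<^sub>M T) (\<lambda>x. (X x, Y x))"
    using ind by (auto simp: indep_var_distribution_eq)
  interpret X: prob_space "distr M S X" by (rule prob_space_distr) fact
  interpret Y: prob_space "distr M T Y" by (rule prob_space_distr) fact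
  interpret XY: pair_prob_space "distr M S X" "distr M T Y" ..
  note [measurable] = f
  have int: "integrable (distr M S X \<Otimes>\<^sub>M distr M T Y) f"
    by (rule XY.integrable_const_bound[of _ B]) (use bound in \<open>auto\<close>)
  have "expectation (\<lambda>\<omega>. f (X \<omega>, Y \<omega>)) = integral\<^sup>L (distr M S X \<Otimes>\<^sub>M distr M T Y) f"
    unfolding eq by (subst integral_distr) simp_all
  also have "\<dots> = (\<integral>x. (\<integral>y. f (x, y) \<partial>distr M T Y) \<partial>distr M S X)"
    by (rule XY.integral_fst'[OF int, symmetric])
  also have "\<dots> = expectation (\<lambda>\<omega>. \<integral>y. f (X \<omega>, y) \<partial>distr M T Y)"
    by (rule integral_distr) (use X in \<open>simp_all\<close>)
  also have "\<dots> = expectation (\<lambda>\<omega>. expectation (\<lambda>\<omega>'. f (X \<omega>, Y \<omega>')))"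
  proof (rule Bochner_Integration.integral_cong[OF refl])
    fix \<omega> assume "\<omega> \<in> space M"
    hence [measurable]: "X \<omega> \<in> space S" using measurable_space[OF X] by blast
    show "(\<integral>y. f (X \<omega>, y) \<partial>distr M T Y) = expectation (\<lambda>\<omega>'. f (X \<omega>, Y \<omega>'))"
      by (rule integral_distr) measurable
  qed
  finally show ?thesis .
qed

text \<open>Causality: the level in slot \<open>i\<close> sees only earlier errors. This is the
  source of its independence from the current error.\<close>

lemma stored_cong:
  assumes "\<And>j. 1 \<le> j \<Longrightarrow> j < i \<Longrightarrow> d j = d' j"
  shows "stored \<alpha>c \<alpha>d s1 \<pi> d i = stored \<alpha>c \<alpha>d s1 \<pi> d' i"
  using assms
proof (induction i rule: less_induct)
  case (less i)
  show ?case
  proof (cases "i < 2")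
    case True
    hence "i = 0 \<or> i = Suc 0" by auto
    thus ?thesis by auto
  next
    case False
    then obtain k where i: "i = Suc (Suc k)" by (metis less_2_cases_iff not0_implies_Suc One_nat_def)
    have *: "stored \<alpha>c \<alpha>d s1 \<pi> d j = stored \<alpha>c \<alpha>d s1 \<pi> d' j" if "j \<le> Suc k" for j
      using less that i by auto
    have "(\<lambda>j\<in>{1..Suc k}. stored \<alpha>c \<alpha>d s1 \<pi> d j) = (\<lambda>j\<in>{1..Suc k}. stored \<alpha>c \<alpha>d s1 \<pi> d' j)"
      "(\<lambda>j\<in>{1..Suc k}. d j) = (\<lambda>j\<in>{1..Suc k}. d' j)"
      using * less.prems i by (auto simp: restrict_def fun_eq_iff)
    thus ?thesis using *[of "Suc k"] i by simp
  qed
qed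

lemma stored_Suc:
  assumes "1 \<le> i" "action \<alpha>c \<alpha>d s1 \<pi> d i = (G, C, D)"
  shows "stored \<alpha>c \<alpha>d s1 \<pi> d (Suc i) = stored \<alpha>c \<alpha>d s1 \<pi> d i + \<alpha>c * C - 1 / \<alpha>d * D"
  using assms by (cases i) (simp_all add: action_def)

text \<open>Levels and actions depend on each other, so \<open>act\<close> is proved relative to
  measurable levels, which the induction then provides. Arbitrary \<open>L\<close> and
  \<open>X\<close> cover both the sample space and the coordinate functions on the product space of
  past errors.\<close>

lemma measurable_stored_action:
  assumes \<pi>: "\<And>i. 1 \<le> i \<Longrightarrow> \<pi> i \<in> borel_measurable
        ((\<Pi>\<^sub>M j\<in>{1..i}. borel) \<Otimes>\<^sub>M (\<Pi>\<^sub>M j\<in>{1..i}. borel))"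
  shows measurable_stored: "(\<And>j. 1 \<le> j \<Longrightarrow> j < i \<Longrightarrow> X j \<in> borel_measurable L) \<Longrightarrow>
      (\<lambda>\<omega>. stored \<alpha>c \<alpha>d s1 \<pi> (\<lambda>j. X j \<omega>) i) \<in> borel_measurable L"
    and measurable_action: "1 \<le> i \<Longrightarrow> (\<And>j. 1 \<le> j \<Longrightarrow> j \<le> i \<Longrightarrow> X j \<in> borel_measurable L) \<Longrightarrow>
      (\<lambda>\<omega>. action \<alpha>c \<alpha>d s1 \<pi> (\<lambda>j. X j \<omega>) i) \<in> borel_measurable L"
proof -
  have act: "(\<lambda>\<omega>. action \<alpha>c \<alpha>d s1 \<pi> (\<lambda>j. X j \<omega>) i) \<in> borel_measurable L"
    if "1 \<le> i" and X: "\<And>j. 1 \<le> j \<Longrightarrow> j \<le> i \<Longrightarrow> X j \<in> borel_measurable L"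
      and S: "\<And>j. 1 \<le> j \<Longrightarrow> j \<le> i \<Longrightarrow>
        (\<lambda>\<omega>. stored \<alpha>c \<alpha>d s1 \<pi> (\<lambda>j. X j \<omega>) j) \<in> borel_measurable L" for i
    unfolding action_def
    by (rule measurable_compose[OF _ \<pi>[OF that(1)]])
      (intro measurable_Pair measurable_restrict X S; simp)
  show stored: "(\<lambda>\<omega>. stored \<alpha>c \<alpha>d s1 \<pi> (\<lambda>j. X j \<omega>) i) \<in> borel_measurable L"
    if "\<And>j. 1 \<le> j \<Longrightarrow> j < i \<Longrightarrow> X j \<in> borel_measurable L" for i
    using that
  proof (induction i rule: less_induct)
    case (less i)
    show ?case
    proof (cases "i < 2")
      case True
      hence "i = 0 \<or> i = Suc 0" by auto
      thus ?thesis by auto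
    next
      case False
      then obtain k where i: "i = Suc k" "1 \<le> k" by (cases i) auto
      define A where "A \<omega> = action \<alpha>c \<alpha>d s1 \<pi> (\<lambda>j. X j \<omega>) k" for \<omega>
      have "A \<in> borel_measurable L"
        unfolding A_def[abs_def] using less i by (intro act) auto
      hence [measurable]: "A \<in> measurable L (borel \<Otimes>\<^sub>M (borel \<Otimes>\<^sub>M borel))"
        by (simp add: borel_prod)
      have [measurable]: "(\<lambda>\<omega>. stored \<alpha>c \<alpha>d s1 \<pi> (\<lambda>j. X j \<omega>) k) \<in> borel_measurable L"
        using less i by auto
      have "stored \<alpha>c \<alpha>d s1 \<pi> (\<lambda>j. X j \<omega>) i = stored \<alpha>c \<alpha>d s1 \<pi> (\<lambda>j. X j \<omega>) k +
          \<alpha>c * fst (snd (A \<omega>)) - 1 / \<alpha>d * snd (snd (A \<omega>))" for \<omega>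
        unfolding i by (rule stored_Suc[OF i(2), of _ _ _ _ _ "fst (A \<omega>)"]) (simp add: A_def)
      thus ?thesis by simp
    qed
  qed
  show "(\<lambda>\<omega>. action \<alpha>c \<alpha>d s1 \<pi> (\<lambda>j. X j \<omega>) i) \<in> borel_measurable L"
    if "1 \<le> i" "\<And>j. 1 \<le> j \<Longrightarrow> j \<le> i \<Longrightarrow> X j \<in> borel_measurable L"
    using that by (intro act stored) auto
qed

lemma measurable_generation:
  assumes "\<And>i. 1 \<le> i \<Longrightarrow> \<pi> i \<in> borel_measurable
        ((\<Pi>\<^sub>M j\<in>{1..i}. borel) \<Otimes>\<^sub>M (\<Pi>\<^sub>M j\<in>{1..i}. borel))"
    and "1 \<le> i" "\<And>j. 1 \<le> j \<Longrightarrow> j \<le> i \<Longrightarrow> X j \<in> borel_measurable L"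
  shows "(\<lambda>\<omega>. generation \<alpha>c \<alpha>d s1 \<pi> (\<lambda>j. X j \<omega>) i) \<in> borel_measurable L"
proof -
  have "(\<lambda>\<omega>. action \<alpha>c \<alpha>d s1 \<pi> (\<lambda>j. X j \<omega>) i) \<in> measurable L (borel \<Otimes>\<^sub>M borel)"
    using measurable_action[OF assms] by (simp add: borel_prod)
  thus ?thesis unfolding generation_def by (rule measurable_compose[OF _ measurable_fst])
qed

section \<open>Closed form of the cost, bounds, and the greedy trajectory\<close>

context storage_system
begin

lemma opt_cost_eq:
  "opt_cost = (1 - exp (- l * Gmax)) / (2 * l) *
     ((1 - \<alpha>c * \<alpha>d) / (1 - \<alpha>c * \<alpha>d * exp (- (1 / \<alpha>c - \<alpha>d) * l * Smax / 2)))"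
proof -
  let ?e = "exp (- kappa * Smax)"
  have e: "- kappa * Smax = - (1 / \<alpha>c - \<alpha>d) * l * Smax / 2"
    by (simp add: kappa_def up_rate_def down_rate_def algebra_simps diff_divide_distrib)
  have f: "up_rate - down_rate = up_rate * (1 - \<alpha>c * \<alpha>d)"
    "up_rate - down_rate * ?e = up_rate * (1 - \<alpha>c * \<alpha>d * ?e)"
    using ac by (simp_all add: up_rate_def down_rate_def right_diff_distrib)
  have "up_rate \<noteq> 0" using ac l by (simp add: up_rate_def)
  hence "opt_cost = (1 - exp (- l * Gmax)) / (2 * l) * ((1 - \<alpha>c * \<alpha>d) / (1 - \<alpha>c * \<alpha>d * ?e))"
    unfolding opt_cost_def f by simp
  thus ?thesis unfolding e .
qed

lemma measurable_bias[measurable]: "bias \<in> borel_measurable borel"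
  unfolding bias_def by measurable

lemma measurable_bellman[measurable]:
  assumes [measurable]: "f \<in> borel_measurable N" "g \<in> borel_measurable N"
  shows "(\<lambda>x. bellman (f x) (g x)) \<in> borel_measurable N"
  unfolding bellman_def greedy_gen_def greedy_next_def gain_def by measurable

definition bias_bound :: real where "bias_bound = max \<bar>bias 0\<bar> \<bar>bias Smax\<bar>"

lemma abs_bias_le: "0 \<le> s \<Longrightarrow> s \<le> Smax \<Longrightarrow> \<bar>bias s\<bar> \<le> bias_bound"
  using bias_antimono[of 0 s] bias_antimono[of s Smax] by (auto simp: bias_bound_def)

text \<open>The clipping in \<open>greedy_next\<close> gives the bound for all real
  \<open>s\<close>, so Fubini applies although the level is in range only almost surely.\<close>

lemma abs_bellman_le: "\<bar>bellman s x\<bar> \<le> Gmax + bias_bound"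
proof -
  have "\<bar>bias (greedy_next s x)\<bar> \<le> bias_bound"
    using Smax by (intro abs_bias_le) (auto simp: greedy_next_def)
  moreover have "\<bar>greedy_gen s x\<bar> \<le> Gmax" using Gmax by (auto simp: greedy_gen_def)
  ultimately show ?thesis unfolding bellman_def by linarith
qed

lemma greedy_policy_slot:
  assumes "0 \<le> S i" "S i \<le> Smax" and act: "greedy_policy \<alpha>c \<alpha>d Gmax Smax i (S, d) = (G, C, D)"
  shows "G = greedy_gen (S i) (d i)"
    and "S i + \<alpha>c * C - 1 / \<alpha>d * D = greedy_next (S i) (d i)"
    and "feasible \<alpha>d Gmax Smax (S i) (d i) (G, C, D)"
proof -
  have ads: "0 \<le> \<alpha>d * S i" using assms ad by simp
  have full: "0 \<le> (Smax - S i) / \<alpha>c" using assms ac by simp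
  \<comment> \<open>\<open>le\<close> and \<open>le2\<close> translate the case tests of the policy
    into the question whether the truncations at \<open>Smax\<close> and 0 are active.\<close>
  have le: "(Smax - S i) / \<alpha>c \<le> d i \<longleftrightarrow> Smax \<le> S i + \<alpha>c * d i" for d
    using ac by (simp add: field_simps)
  have le2: "- \<alpha>d * S i \<le> d i \<longleftrightarrow> 0 \<le> S i + d i / \<alpha>d" for d
    using ad by (auto simp: field_simps)
  have c0: "d i < 0 \<Longrightarrow> d i / \<alpha>d < 0" for d using ad by (simp add: divide_neg_pos)
  have c1: "0 \<le> d i \<Longrightarrow> 0 \<le> \<alpha>c * d i" for d using ac by simp
  show "G = greedy_gen (S i) (d i)"
    using act ads full Gmax by (auto simp: greedy_policy_def greedy_gen_def split: if_splits)
  show "S i + \<alpha>c * C - 1 / \<alpha>d * D = greedy_next (S i) (d i)"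
  proof (cases "0 \<le> d i")
    case True
    thus ?thesis using act assms(1,2) ac le[of d] c1
      by (auto simp: greedy_policy_def greedy_next_def gain_def split: if_splits)
  next
    case False
    hence "\<not> (Smax - S i) / \<alpha>c \<le> d i" using full by linarith
    thus ?thesis using False act assms(1,2) ad le2[of d] c0[of d] Gmax
      by (auto simp: greedy_policy_def greedy_next_def gain_def split: if_splits)
  qed
  show "feasible \<alpha>d Gmax Smax (S i) (d i) (G, C, D)"
    using act ads full Gmax assms(1,2)
    by (auto simp: greedy_policy_def feasible_def split: if_splits)
qed

text \<open>\<open>slot\<close> presupposes a level within its limits; the induction closes the
  circle, since \<open>greedy_next\<close> never leaves them. Thus \<open>bellman_le\<close> is
  tight along every error sequence.\<close>

lemma greedy_stored:
  fixes \<pi>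
  defines "\<pi> \<equiv> greedy_policy \<alpha>c \<alpha>d Gmax Smax"
  assumes s1: "0 \<le> s1" "s1 \<le> Smax"
  shows greedy_stored_bounds: "1 \<le> i \<Longrightarrow>
      0 \<le> stored \<alpha>c \<alpha>d s1 \<pi> d i \<and> stored \<alpha>c \<alpha>d s1 \<pi> d i \<le> Smax"
    and greedy_bellman: "1 \<le> i \<Longrightarrow> bellman (stored \<alpha>c \<alpha>d s1 \<pi> d i) (d i) =
      generation \<alpha>c \<alpha>d s1 \<pi> d i + bias (stored \<alpha>c \<alpha>d s1 \<pi> d (Suc i))"
    and greedy_feasible: "1 \<le> i \<Longrightarrow>
      feasible \<alpha>d Gmax Smax (stored \<alpha>c \<alpha>d s1 \<pi> d i) (d i) (action \<alpha>c \<alpha>d s1 \<pi> d i)"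
proof -
  let ?S = "stored \<alpha>c \<alpha>d s1 \<pi> d"
  have slot: "generation \<alpha>c \<alpha>d s1 \<pi> d i = greedy_gen (?S i) (d i) \<and>
      ?S (Suc i) = greedy_next (?S i) (d i) \<and>
      feasible \<alpha>d Gmax Smax (?S i) (d i) (action \<alpha>c \<alpha>d s1 \<pi> d i)"
    if i: "1 \<le> i" "0 \<le> ?S i" "?S i \<le> Smax" for i
  proof -
    let ?Sr = "\<lambda>j\<in>{1..i}. ?S j" and ?dr = "\<lambda>j\<in>{1..i}. d j"
    obtain G C D where act: "action \<alpha>c \<alpha>d s1 \<pi> d i = (G, C, D)" by (metis prod_cases3)
    have r: "?Sr i = ?S i" "?dr i = d i" using i by auto
    have "greedy_policy \<alpha>c \<alpha>d Gmax Smax i (?Sr, ?dr) = (G, C, D)"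
      using act by (simp add: action_def \<pi>_def)
    from greedy_policy_slot[OF _ _ this] i act stored_Suc[OF i(1) act] show ?thesis
      unfolding r by (auto simp: generation_def)
  qed
  show bounds: "0 \<le> ?S i \<and> ?S i \<le> Smax" if "1 \<le> i" for i
    using that
  proof (induction i rule: dec_induct)
    case base
    thus ?case using s1 by simp
  next
    case (step n)
    thus ?case using slot[of n] Smax by (auto simp: greedy_next_def)
  qed
  show "bellman (?S i) (d i) = generation \<alpha>c \<alpha>d s1 \<pi> d i + bias (?S (Suc i))"
    "feasible \<alpha>d Gmax Smax (?S i) (d i) (action \<alpha>c \<alpha>d s1 \<pi> d i)" if "1 \<le> i"
    using slot[OF that] bounds[OF that] by (auto simp: bellman_def)
qed

lemma measurable_greedy_policy:
  assumes "1 \<le> i"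
  shows "greedy_policy \<alpha>c \<alpha>d Gmax Smax i \<in> borel_measurable
        ((\<Pi>\<^sub>M j\<in>{1..i}. borel) \<Otimes>\<^sub>M (\<Pi>\<^sub>M j\<in>{1..i}. borel))"
proof -
  let ?N = "(\<Pi>\<^sub>M j\<in>{1..i}. borel :: real measure) \<Otimes>\<^sub>M (\<Pi>\<^sub>M j\<in>{1..i}. borel :: real measure)"
  have i: "i \<in> {1..i}" using assms by simp
  have [measurable]: "(\<lambda>p. fst p i) \<in> borel_measurable ?N" "(\<lambda>p. snd p i) \<in> borel_measurable ?N"
    using measurable_compose[OF measurable_fst measurable_component_singleton[OF i]]
      measurable_compose[OF measurable_snd measurable_component_singleton[OF i]] by auto
  have "greedy_policy \<alpha>c \<alpha>d Gmax Smax i \<in> measurable ?N (borel \<Otimes>\<^sub>M (borel \<Otimes>\<^sub>M borel))"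
    unfolding greedy_policy_def case_prod_beta' by measurable
  thus ?thesis by (simp add: borel_prod)
qed

end

section \<open>Expected generation\<close>

locale laplace_storage = storage_system \<alpha>c \<alpha>d Gmax Smax l + prob_space M
  for M :: "'a measure" and \<alpha>c \<alpha>d Gmax Smax l :: real +
  fixes \<Delta> :: "nat \<Rightarrow> 'a \<Rightarrow> real" and s1 :: real
  assumes s1: "0 \<le> s1" "s1 \<le> Smax"
    and indep: "indep_vars (\<lambda>_. borel) \<Delta> {1..}"
    and laplace: "1 \<le> i \<Longrightarrow> distributed M lborel (\<Delta> i) (\<lambda>x. ennreal (laplace_density l x))"
begin

abbreviation level :: "policy \<Rightarrow> nat \<Rightarrow> 'a \<Rightarrow> real" where
  "level \<pi> i \<omega> \<equiv> stored \<alpha>c \<alpha>d s1 \<pi> (\<lambda>j. \<Delta> j \<omega>) i"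

abbreviation gen :: "policy \<Rightarrow> nat \<Rightarrow> 'a \<Rightarrow> real" where
  "gen \<pi> i \<omega> \<equiv> generation \<alpha>c \<alpha>d s1 \<pi> (\<lambda>j. \<Delta> j \<omega>) i"

abbreviation adm :: "policy \<Rightarrow> bool" where
  "adm \<equiv> admissible M \<Delta> \<alpha>c \<alpha>d Gmax Smax s1"

lemma measurable_error: "1 \<le> i \<Longrightarrow> \<Delta> i \<in> borel_measurable M"
  using distributed_measurable[OF laplace] by simp

text \<open>Boundedness makes the integrand Lebesgue integrable, and uniqueness identifies its
  integral with the gauge integral in \<open>has_integral_bellman\<close>.\<close>

lemma expectation_bellman:
  assumes "1 \<le> i" "0 \<le> s" "s \<le> Smax"
  shows "expectation (\<lambda>\<omega>. bellman s (\<Delta> i \<omega>)) = opt_cost + bias s"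
proof -
  have nonneg: "0 \<le> laplace_density l x" for x using l by (simp add: laplace_density_def)
  have [measurable]: "\<Delta> i \<in> borel_measurable M" using measurable_error assms by simp
  have "integrable M (\<lambda>\<omega>. bellman s (\<Delta> i \<omega>))"
    by (rule integrable_const_bound[of _ "Gmax + bias_bound"]) (simp_all add: abs_bellman_le)
  hence "integrable lborel (\<lambda>x. laplace_density l x * bellman s x)"
    using distributed_integrable[OF laplace[OF assms(1)], of "bellman s"] nonneg by simp
  from has_integral_unique[OF has_integral_integral_lborel[OF this] has_integral_bellman[OF assms(2,3)]]
  show ?thesis
    using distributed_integral[OF laplace[OF assms(1)], of "bellman s"] nonneg by simp
qed

text \<open>The level is a function of earlier errors, hence independent of the current one, and the
  optimality equation applies with the level frozen. The bounds come from feasibility.\<close>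

lemma expectation_bellman_level:
  assumes \<pi>: "adm \<pi>" and i: "1 \<le> i"
  shows "expectation (\<lambda>\<omega>. bellman (level \<pi> i \<omega>) (\<Delta> i \<omega>)) =
    opt_cost + expectation (\<lambda>\<omega>. bias (level \<pi> i \<omega>))"
    and "integrable M (\<lambda>\<omega>. bias (level \<pi> i \<omega>))"
    and "integrable M (gen \<pi> i)"
    and "\<bar>expectation (\<lambda>\<omega>. bias (level \<pi> i \<omega>))\<bar> \<le> bias_bound"
proof -
  let ?P = "\<lambda>A. \<Pi>\<^sub>M j\<in>A. (borel :: real measure)"
  have meas: "\<And>i. 1 \<le> i \<Longrightarrow> \<pi> i \<in> borel_measurable (?P {1..i} \<Otimes>\<^sub>M ?P {1..i})"
    and AE: "AE \<omega> in M. \<forall>i\<ge>1. feasible \<alpha>d Gmax Smax (level \<pi> i \<omega>) (\<Delta> i \<omega>)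
          (action \<alpha>c \<alpha>d s1 \<pi> (\<lambda>j. \<Delta> j \<omega>) i)"
    using \<pi> by (auto simp: admissible_def)
  have level[measurable]: "level \<pi> i \<in> borel_measurable M"
    by (rule measurable_stored[OF meas]) (simp_all add: measurable_error)
  have gen[measurable]: "gen \<pi> i \<in> borel_measurable M"
    by (rule measurable_generation[OF meas i]) (simp_all add: measurable_error)
  have bounds: "AE \<omega> in M. 0 \<le> level \<pi> i \<omega> \<and> level \<pi> i \<omega> \<le> Smax \<and> 0 \<le> gen \<pi> i \<omega> \<and> gen \<pi> i \<omega> \<le> Gmax"
    using AE by eventually_elim
      (use i in \<open>fastforce simp: feasible_def generation_def split: prod.splits\<close>)
  have bias: "AE \<omega> in M. \<bar>bias (level \<pi> i \<omega>)\<bar> \<le> bias_bound"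
    using bounds by eventually_elim (simp add: abs_bias_le)
  show int: "integrable M (\<lambda>\<omega>. bias (level \<pi> i \<omega>))"
    by (rule integrable_const_bound[of _ bias_bound]) (use bias in simp_all)
  show "integrable M (gen \<pi> i)"
    by (rule integrable_const_bound[of _ Gmax]) (use bounds in auto)
  have "\<bar>expectation (\<lambda>\<omega>. bias (level \<pi> i \<omega>))\<bar> \<le> expectation (\<lambda>\<omega>. \<bar>bias (level \<pi> i \<omega>)\<bar>)"
    by (rule integral_abs_bound)
  also have "\<dots> \<le> bias_bound"
    by (rule integral_le_const) (use bias int in auto)
  finally show "\<bar>expectation (\<lambda>\<omega>. bias (level \<pi> i \<omega>))\<bar> \<le> bias_bound" .

  \<comment> \<open>For \<open>i = 1\<close> the past is the empty family and the level is the
    constant \<open>s1\<close>.\<close>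
  let ?X = "\<lambda>\<omega>. \<lambda>j\<in>{1..<i}. \<Delta> j \<omega>" and ?Y = "\<lambda>\<omega>. \<lambda>j\<in>{i}. \<Delta> j \<omega>"
  let ?f = "\<lambda>p. bellman (stored \<alpha>c \<alpha>d s1 \<pi> (fst p) i) (snd p i)"
  have ind: "indep_var (?P {1..<i}) ?X (?P {i}) ?Y"
    by (rule indep_var_restrict[OF indep]) (use i in auto)
  have comp: "(\<lambda>d. d j) \<in> borel_measurable (?P A)" if "j \<in> A" for j A
    using that by (rule measurable_component_singleton)
  have "(\<lambda>d. stored \<alpha>c \<alpha>d s1 \<pi> (\<lambda>j. d j) i) \<in> borel_measurable (?P {1..<i})"
    by (rule measurable_stored[OF meas]) (auto intro: comp)
  hence [measurable]: "(\<lambda>p. stored \<alpha>c \<alpha>d s1 \<pi> (fst p) i) \<in> borel_measurable (?P {1..<i} \<Otimes>\<^sub>M ?P {i})"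
    using measurable_compose[OF measurable_fst] by auto
  have [measurable]: "(\<lambda>p. snd p i) \<in> borel_measurable (?P {1..<i} \<Otimes>\<^sub>M ?P {i})"
    using measurable_compose[OF measurable_snd comp[of i "{i}"]] by auto
  have level_X: "stored \<alpha>c \<alpha>d s1 \<pi> (?X \<omega>) i = level \<pi> i \<omega>" for \<omega>
    by (rule stored_cong) auto
  have "expectation (\<lambda>\<omega>. ?f (?X \<omega>, ?Y \<omega>)) = expectation (\<lambda>\<omega>. expectation (\<lambda>\<omega>'. ?f (?X \<omega>, ?Y \<omega>')))"
    by (rule indep_var_expectation[OF ind _ abs_bellman_le]) measurable
  hence "expectation (\<lambda>\<omega>. bellman (level \<pi> i \<omega>) (\<Delta> i \<omega>)) =
      expectation (\<lambda>\<omega>. expectation (\<lambda>\<omega>'. bellman (level \<pi> i \<omega>) (\<Delta> i \<omega>')))"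
    by (simp only: fst_conv snd_conv level_X restrict_apply' singletonI)
  also have "\<dots> = expectation (\<lambda>\<omega>. opt_cost + bias (level \<pi> i \<omega>))"
  proof (rule integral_cong_AE)
    \<comment> \<open>As an integral over the law of the error, the inner expectation has a jointly
      measurable integrand and is therefore measurable in \<omega>.\<close>
    have "random_variable borel (\<lambda>\<omega>. integral\<^sup>L (distr M borel (\<Delta> i)) (\<lambda>x. bellman (level \<pi> i \<omega>) x))"
    proof -
      interpret D: prob_space "distr M borel (\<Delta> i)"
        by (rule prob_space_distr) (use measurable_error i in simp)
      show ?thesis by measurable
    qed
    moreover have "integral\<^sup>L (distr M borel (\<Delta> i)) (\<lambda>x. bellman (level \<pi> i \<omega>) x) =
        expectation (\<lambda>\<omega>'. bellman (level \<pi> i \<omega>) (\<Delta> i \<omega>'))" for \<omega>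
      by (rule integral_distr) (use measurable_error i in auto)
    ultimately show "random_variable borel (\<lambda>\<omega>. expectation (\<lambda>\<omega>'. bellman (level \<pi> i \<omega>) (\<Delta> i \<omega>')))"
      by simp
    show "AE \<omega> in M. expectation (\<lambda>\<omega>'. bellman (level \<pi> i \<omega>) (\<Delta> i \<omega>')) = opt_cost + bias (level \<pi> i \<omega>)"
      using bounds by eventually_elim (use expectation_bellman[OF i] in simp)
  qed measurable
  also have "\<dots> = opt_cost + expectation (\<lambda>\<omega>. bias (level \<pi> i \<omega>))"
    using int by (simp add: prob_space)
  finally show "expectation (\<lambda>\<omega>. bellman (level \<pi> i \<omega>) (\<Delta> i \<omega>)) =
    opt_cost + expectation (\<lambda>\<omega>. bias (level \<pi> i \<omega>))" .
qed

section \<open>Telescoping and the long-run average\<close>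

lemma expected_average:
  assumes "adm \<pi>"
  shows "expectation (\<lambda>\<omega>. 1 / real n * (\<Sum>i=1..n. gen \<pi> i \<omega>)) =
    (\<Sum>i=1..n. expectation (gen \<pi> i)) / real n"
proof -
  have "expectation (\<lambda>\<omega>. \<Sum>i=1..n. gen \<pi> i \<omega>) = (\<Sum>i=1..n. expectation (gen \<pi> i))"
    using expectation_bellman_level(3)[OF assms] by (intro Bochner_Integration.integral_sum) simp
  thus ?thesis by simp
qed

lemma expected_generation_ge:
  assumes \<pi>: "adm \<pi>" and i: "1 \<le> i"
  shows "opt_cost + expectation (\<lambda>\<omega>. bias (level \<pi> i \<omega>)) -
    expectation (\<lambda>\<omega>. bias (level \<pi> (Suc i) \<omega>)) \<le> expectation (gen \<pi> i)"
proof -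
  note E = expectation_bellman_level[OF \<pi> i] expectation_bellman_level[OF \<pi>, of "Suc i"]
  have AE: "AE \<omega> in M. \<forall>i\<ge>1. feasible \<alpha>d Gmax Smax (level \<pi> i \<omega>) (\<Delta> i \<omega>)
          (action \<alpha>c \<alpha>d s1 \<pi> (\<lambda>j. \<Delta> j \<omega>) i)"
    and meas: "\<And>i. 1 \<le> i \<Longrightarrow> \<pi> i \<in> borel_measurable
        ((\<Pi>\<^sub>M j\<in>{1..i}. borel) \<Otimes>\<^sub>M (\<Pi>\<^sub>M j\<in>{1..i}. borel))"
    using \<pi> by (auto simp: admissible_def)
  have [measurable]: "level \<pi> i \<in> borel_measurable M" "\<Delta> i \<in> borel_measurable M"
    using i by (auto intro!: measurable_stored[OF meas] measurable_error)
  have "AE \<omega> in M. bellman (level \<pi> i \<omega>) (\<Delta> i \<omega>) \<le> gen \<pi> i \<omega> + bias (level \<pi> (Suc i) \<omega>)"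
    using AE
  proof eventually_elim
    case (elim \<omega>)
    obtain G C D where act: "action \<alpha>c \<alpha>d s1 \<pi> (\<lambda>j. \<Delta> j \<omega>) i = (G, C, D)" by (metis prod_cases3)
    \<comment> \<open>Feasibility in the following slot is what bounds the level reached after slot
      \<open>i\<close>.\<close>
    have "feasible \<alpha>d Gmax Smax (level \<pi> (Suc i) \<omega>) (\<Delta> (Suc i) \<omega>)
        (action \<alpha>c \<alpha>d s1 \<pi> (\<lambda>j. \<Delta> j \<omega>) (Suc i))" using elim by simp
    hence "0 \<le> level \<pi> (Suc i) \<omega>" "level \<pi> (Suc i) \<omega> \<le> Smax" by (auto simp: feasible_def)
    with elim i act show ?case
      using bellman_le[OF _ stored_Suc[OF i act]] by (auto simp: generation_def)
  qed
  hence "expectation (\<lambda>\<omega>. bellman (level \<pi> i \<omega>) (\<Delta> i \<omega>)) \<le>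
      expectation (\<lambda>\<omega>. gen \<pi> i \<omega> + bias (level \<pi> (Suc i) \<omega>))"
    by (intro integral_mono_AE integrable_const_bound[of _ "Gmax + bias_bound"]
        Bochner_Integration.integrable_add E) (auto simp: abs_bellman_le)
  thus ?thesis using E by simp
qed

text \<open>Summation leaves only the first and last expected bias, each bounded by
  \<open>bias_bound\<close>; their share vanishes after division by \<open>n\<close>.\<close>

lemma avg_generation_ge:
  assumes \<pi>: "adm \<pi>"
  shows "ereal opt_cost \<le> avg_generation M \<Delta> \<alpha>c \<alpha>d s1 \<pi>"
proof -
  let ?e = "\<lambda>i. expectation (\<lambda>\<omega>. bias (level \<pi> i \<omega>))"
  have sum: "real n * opt_cost + ?e 1 - ?e (Suc n) \<le> (\<Sum>i=1..n. expectation (gen \<pi> i))" for n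
  proof (induction n)
    case (Suc n)
    show ?case using Suc expected_generation_ge[OF \<pi>, of "Suc n"] by (simp add: algebra_simps)
  qed simp
  have le: "opt_cost - 2 * bias_bound / real n \<le>
      expectation (\<lambda>\<omega>. 1 / real n * (\<Sum>i=1..n. gen \<pi> i \<omega>))" if "1 \<le> n" for n
  proof -
    have "real n * opt_cost - 2 * bias_bound \<le> (\<Sum>i=1..n. expectation (gen \<pi> i))"
      using sum[of n] expectation_bellman_level(4)[OF \<pi>, of 1]
        expectation_bellman_level(4)[OF \<pi>, of "Suc n"] by (simp add: abs_le_iff)
    hence "(real n * opt_cost - 2 * bias_bound) / real n \<le> (\<Sum>i=1..n. expectation (gen \<pi> i)) / real n"
      by (rule divide_right_mono) simp
    thus ?thesis unfolding expected_average[OF \<pi>] using that by (simp add: diff_divide_distrib)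
  qed
  have "(\<lambda>n. opt_cost - 2 * bias_bound / real n) \<longlonglongrightarrow> opt_cost"
    using tendsto_diff[OF tendsto_const lim_const_over_n] by simp
  hence "ereal opt_cost = limsup (\<lambda>n. ereal (opt_cost - 2 * bias_bound / real n))"
    by (intro lim_imp_Limsup[symmetric]) auto
  also have "\<dots> \<le> avg_generation M \<Delta> \<alpha>c \<alpha>d s1 \<pi>"
    unfolding avg_generation_def
    by (rule Limsup_mono) (use le in \<open>auto intro!: eventually_sequentiallyI[of 1]\<close>)
  finally show ?thesis .
qed

lemma admissible_greedy: "adm (greedy_policy \<alpha>c \<alpha>d Gmax Smax)"
  unfolding admissible_def
  using measurable_greedy_policy greedy_feasible[OF s1, of _ "\<lambda>j. \<Delta> j \<omega>" for \<omega>] by auto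

text \<open>Each slot now gives an equality, so the averages differ from \<open>opt_cost\<close> by
  O(1/n) and the limsup is a limit.\<close>

lemma avg_generation_greedy:
  "avg_generation M \<Delta> \<alpha>c \<alpha>d s1 (greedy_policy \<alpha>c \<alpha>d Gmax Smax) = ereal opt_cost"
proof -
  define \<pi> where "\<pi> = greedy_policy \<alpha>c \<alpha>d Gmax Smax"
  note \<pi> = admissible_greedy[folded \<pi>_def]
  let ?e = "\<lambda>i. expectation (\<lambda>\<omega>. bias (level \<pi> i \<omega>))"
  have step: "expectation (gen \<pi> i) = opt_cost + ?e i - ?e (Suc i)" if i: "1 \<le> i" for i
  proof -
    note E = expectation_bellman_level[OF \<pi> i] expectation_bellman_level[OF \<pi>, of "Suc i"]
    have "bellman (level \<pi> i \<omega>) (\<Delta> i \<omega>) = gen \<pi> i \<omega> + bias (level \<pi> (Suc i) \<omega>)" for \<omega>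
      using greedy_bellman[OF s1 i, of "\<lambda>j. \<Delta> j \<omega>"] by (simp add: \<pi>_def)
    hence "opt_cost + ?e i = expectation (\<lambda>\<omega>. gen \<pi> i \<omega> + bias (level \<pi> (Suc i) \<omega>))"
      using E(1) by simp
    thus ?thesis using E by simp
  qed
  have sum: "(\<Sum>i=1..n. expectation (gen \<pi> i)) = real n * opt_cost + ?e 1 - ?e (Suc n)" for n
    by (induction n) (simp_all add: step algebra_simps)
  let ?a = "\<lambda>n. expectation (\<lambda>\<omega>. 1 / real n * (\<Sum>i=1..n. gen \<pi> i \<omega>))"
  have bound: "norm (?a n - opt_cost) \<le> 2 * bias_bound / real n" if "1 \<le> n" for n
  proof -
    have "?a n - opt_cost = (?e 1 - ?e (Suc n)) / real n"
      unfolding expected_average[OF \<pi>] sum using that by (simp add: field_simps)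
    moreover have "\<bar>?e 1 - ?e (Suc n)\<bar> \<le> 2 * bias_bound"
      using expectation_bellman_level(4)[OF \<pi>, of 1]
        expectation_bellman_level(4)[OF \<pi>, of "Suc n"] by (simp add: abs_le_iff)
    ultimately show ?thesis by (simp add: divide_right_mono)
  qed
  have "(\<lambda>n. ?a n - opt_cost) \<longlonglongrightarrow> 0"
    by (rule Lim_null_comparison[of _ "\<lambda>n. 2 * bias_bound / real n"])
      (use bound in \<open>auto intro!: eventually_sequentiallyI[of 1] lim_const_over_n\<close>)
  hence "?a \<longlonglongrightarrow> opt_cost" by (simp only: LIM_zero_iff)
  thus ?thesis unfolding avg_generation_def \<pi>_def[symmetric]
    by (intro lim_imp_Limsup) auto
qed

end

theorem proposition2:
  fixes M :: "'a measure" and \<Delta> :: "nat \<Rightarrow> 'a \<Rightarrow> real"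
    and l \<alpha>c \<alpha>d \<alpha> Gmax Smax s1 :: real
  assumes "0 < \<alpha>c" "\<alpha>c < 1" "0 < \<alpha>d" "\<alpha>d < 1" "\<alpha> = \<alpha>c * \<alpha>d"
    and "0 \<le> Gmax" "0 \<le> Smax" "0 \<le> s1" "s1 \<le> Smax" "0 < l"
    and "prob_space M"
    and "prob_space.indep_vars M (\<lambda>_. borel) \<Delta> {1..}"
    and "\<And>i. 1 \<le> i \<Longrightarrow> distributed M lborel (\<Delta> i) (\<lambda>x. ennreal (laplace_density l x))"
  shows "is_arg_min (avg_generation M \<Delta> \<alpha>c \<alpha>d s1)
           (admissible M \<Delta> \<alpha>c \<alpha>d Gmax Smax s1) (greedy_policy \<alpha>c \<alpha>d Gmax Smax) \<and>
         avg_generation M \<Delta> \<alpha>c \<alpha>d s1 (greedy_policy \<alpha>c \<alpha>d Gmax Smax) =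
           ereal ((1 - exp (- l * Gmax)) / (2 * l) *
             ((1 - \<alpha>) / (1 - \<alpha> * exp (- (1 / \<alpha>c - \<alpha>d) * l * Smax / 2))))"
proof -
  interpret prob_space M by fact
  interpret laplace_storage M \<alpha>c \<alpha>d Gmax Smax l \<Delta> s1
    using assms by unfold_locales auto
  show ?thesis
    using admissible_greedy avg_generation_ge avg_generation_greedy opt_cost_eq assms(5)
    by (simp add: is_arg_min_linorder)
qed

end
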